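(* Let $X$ be a (real) Banach space and let $E$ be a real Archimedean vector lattice such that: (a) $E$ is Dedekind $\sigma$-complete; (b) $\tau$ is a metrisable, Hausdorff, locally solid linear topology on $E$ that has the $\sigma$-Lebesgue property; (c) $T_n \colon X \to E$, $n \in \mathbb{N}$, are linear operators that are continuous with respect to the norm topology on $X$ and the topology $\tau$ on $E$; (d) for each $x \in X$ the sequence $(T_n x)_{n \in \mathbb{N}}$ is order bounded in $E$. Then the following two assertions hold: (i) The convergence set $C := \{x \in X : (T_n x)_{n \in \mathbb{N}} \text{ is order convergent in } E\}$ is a closed subspace of $X$. (ii) If there exists a dense subset $D \subseteq X$ such that $(T_n x)_{n \in \mathbb{N}}$ is order convergent in $E$ for each $x \in D$, then $C = X$.
   Context: A vector lattice $E$ is Dedekind $\sigma$-complete if every countable non-empty subset of $E$ which is bounded above has a supremum. A sequence $(x_n)$ in $E$ is order convergent to $x \in E$ if there is a sequence $(y_n)$ in $E$ with $y_n \downarrow 0$ (i.e. decreasing with $\inf_n y_n = 0$) and $|x_n - x| \le y_n$ for each $n$. A set is order bounded if it is contained in an order interval $[a,b]$. A subset $A \subseteq E$ is solid if $|y| \le |x|$ and $x \in A$ imply $y \in A$. A linear topology on $E$ is locally solid if it admits a neighbourhood base of zero consisting of solid sets. It has the $\sigma$-Lebesgue property if, for every sequence, $x_n \downarrow 0$ implies $x_n \to 0$ in $\tau$. *)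

theory Defs
  imports "HOL-Analysis.Analysis" "HOL-Library.Lattice_Algebras" "HOL-Library.Lub_Glb"
begin

text \<open>
  A real vector lattice is a type of sort \<open>{ordered_real_vector, lattice_ab_group_add_abs}\<close>:
  a real vector space with a compatible lattice order, where \<open>\<bar>x\<bar> = sup x (- x)\<close> is a class axiom.
  Since such a lattice need not be conditionally complete, suprema and infima of sets are expressed
  relationally by \<^const>\<open>isLub\<close> and \<^const>\<open>isGlb\<close> relative to the whole space.
\<close>

definition archimedean_lattice ::
    "'e::{ordered_real_vector, lattice_ab_group_add_abs} itself \<Rightarrow> bool" where
  "archimedean_lattice _ \<longleftrightarrow>
     (\<forall>x y :: 'e. (\<forall>n::nat. real n *\<^sub>R x \<le> y) \<longrightarrow> x \<le> 0)"

definition dedekind_sigma_complete ::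
    "'e::{ordered_real_vector, lattice_ab_group_add_abs} itself \<Rightarrow> bool" where
  "dedekind_sigma_complete _ \<longleftrightarrow>
     (\<forall>A :: 'e set. countable A \<and> A \<noteq> {} \<and> bdd_above A \<longrightarrow> (\<exists>s. isLub UNIV A s))"

definition decreases_to ::
    "(nat \<Rightarrow> 'e::{ordered_real_vector, lattice_ab_group_add_abs}) \<Rightarrow> 'e \<Rightarrow> bool" where
  "decreases_to y l \<longleftrightarrow> decseq y \<and> isGlb UNIV (range y) l"

definition order_converges_to ::
    "(nat \<Rightarrow> 'e::{ordered_real_vector, lattice_ab_group_add_abs}) \<Rightarrow> 'e \<Rightarrow> bool" where
  "order_converges_to x l \<longleftrightarrow> (\<exists>y. decreases_to y 0 \<and> (\<forall>n. \<bar>x n - l\<bar> \<le> y n))"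

definition order_convergent ::
    "(nat \<Rightarrow> 'e::{ordered_real_vector, lattice_ab_group_add_abs}) \<Rightarrow> bool" where
  "order_convergent x \<longleftrightarrow> (\<exists>l. order_converges_to x l)"

definition order_bounded ::
    "'e::{ordered_real_vector, lattice_ab_group_add_abs} set \<Rightarrow> bool" where
  "order_bounded A \<longleftrightarrow> (\<exists>a b. A \<subseteq> {a..b})"

definition solid ::
    "'e::{ordered_real_vector, lattice_ab_group_add_abs} set \<Rightarrow> bool" where
  "solid A \<longleftrightarrow> (\<forall>x y. \<bar>y\<bar> \<le> \<bar>x\<bar> \<and> x \<in> A \<longrightarrow> y \<in> A)"

text \<open>
  The topology is an explicit \<^typ>\<open>'e topology\<close> on the whole type, independent of any
  type-class topology on \<^typ>\<open>'e\<close>.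
\<close>

definition linear_topology :: "'e::real_vector topology \<Rightarrow> bool" where
  "linear_topology \<tau> \<longleftrightarrow>
     topspace \<tau> = UNIV \<and>
     continuous_map (prod_topology \<tau> \<tau>) \<tau> (\<lambda>(x, y). x + y) \<and>
     continuous_map (prod_topology euclideanreal \<tau>) \<tau> (\<lambda>(c, x). c *\<^sub>R x)"

definition locally_solid ::
    "'e::{ordered_real_vector, lattice_ab_group_add_abs} topology \<Rightarrow> bool" where
  "locally_solid \<tau> \<longleftrightarrow> neighbourhood_base_at 0 solid \<tau>"

definition sigma_Lebesgue ::
    "'e::{ordered_real_vector, lattice_ab_group_add_abs} topology \<Rightarrow> bool" where
  "sigma_Lebesgue \<tau> \<longleftrightarrow> (\<forall>x. decreases_to x 0 \<longrightarrow> limitin \<tau> x 0 sequentially)"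

definition convergence_set ::
    "(nat \<Rightarrow> 'x \<Rightarrow> 'e::{ordered_real_vector, lattice_ab_group_add_abs}) \<Rightarrow> 'x set" where
  "convergence_set T = {x. order_convergent (\<lambda>n. T n x)}"

end

theory Submission
  imports Defs
begin

text \<open>
  Put \<open>M x = sup\<^sub>n \<bar>T\<^sub>n x\<bar>\<close>. The \<open>\<sigma>\<close>-Lebesgue property makes the finite maxima converge to \<open>M\<close>
  topologically, so a Banach--Steinhaus argument via Baire's theorem shows that \<open>M\<close> is continuous
  at \<open>0\<close>. The order oscillation of \<open>(T\<^sub>n x)\<close> is at most \<open>2 M (x - y)\<close> for every \<open>y\<close> in the
  convergence set, hence it vanishes for \<open>x\<close> in the closure of that set, because \<open>\<tau>\<close> is Hausdorff.
  By \<open>\<sigma>\<close>-completeness, a sequence with zero order oscillation is order convergent.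
\<close>

section \<open>Order convergence\<close>

lemma isLub_UNIV_iff:
  "isLub UNIV A (s::'a::order) \<longleftrightarrow> (\<forall>a\<in>A. a \<le> s) \<and> (\<forall>b. (\<forall>a\<in>A. a \<le> b) \<longrightarrow> s \<le> b)"
  by (auto simp: isLub_def leastP_def isUb_def setle_def setge_def)

lemma decreases_to_0_iff:
  "decreases_to y 0 \<longleftrightarrow> decseq y \<and> (\<forall>n. 0 \<le> y n) \<and> (\<forall>b. (\<forall>n. b \<le> y n) \<longrightarrow> b \<le> 0)"
  by (auto simp: decreases_to_def isGlb_def greatestP_def isLb_def setle_def setge_def)

text \<open>The two indices have to be decoupled: evaluating a lower bound at \<open>max m n\<close>
  bounds it by \<open>y n + z m\<close> for independent \<open>n\<close> and \<open>m\<close>, and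
  the two infima are then taken one after the other.\<close>

lemma decreases_to_0_add:
  assumes "decreases_to y 0" "decreases_to z 0"
  shows "decreases_to (\<lambda>n. y n + z n) 0"
proof -
  have "b \<le> 0" if b: "\<And>n. b \<le> y n + z n" for b
  proof -
    have "b - z m \<le> y n" for m n
    proof -
      have "b \<le> y (max m n) + z (max m n)" by (rule b)
      also have "\<dots> \<le> y n + z m"
        using assms by (intro add_mono) (auto simp: decreases_to_0_iff decseq_def)
      finally show ?thesis by (simp add: algebra_simps)
    qed
    then have "b - z m \<le> 0" for m
      using assms(1) unfolding decreases_to_0_iff by blast
    then have "b \<le> z m" for m
      by simp
    then show ?thesis
      using assms(2) unfolding decreases_to_0_iff by blast
  qed
  then show ?thesis
    using assms by (auto simp: decreases_to_0_iff decseq_def intro!: add_mono)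
qed

lemma decreases_to_0_scaleR:
  fixes y :: "nat \<Rightarrow> 'e::{ordered_real_vector, lattice_ab_group_add_abs}"
  assumes "decreases_to y 0" "0 < c"
  shows "decreases_to (\<lambda>n. c *\<^sub>R y n) 0"
proof -
  have "b \<le> 0" if b: "\<And>n. b \<le> c *\<^sub>R y n" for b
  proof -
    have "inverse c *\<^sub>R b \<le> y n" for n
      using scaleR_left_mono[OF b[of n], of "inverse c"] assms(2) by simp
    then have "inverse c *\<^sub>R b \<le> 0"
      using assms(1) unfolding decreases_to_0_iff by blast
    from scaleR_left_mono[OF this, of c] show ?thesis
      using assms(2) by simp
  qed
  then show ?thesis
    using assms by (auto simp: decreases_to_0_iff decseq_def intro!: scaleR_left_mono scaleR_nonneg_nonneg)
qed

text \<open>Scaling \<open>x \<le> \<bar>x\<bar>\<close> and \<open>- x \<le> \<bar>x\<bar>\<close>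
  by the nonnegative number \<open>\<bar>c\<bar>\<close> bounds both \<open>c *\<^sub>R x\<close>
  and its negative.\<close>

lemma abs_scaleR_le:
  fixes x :: "'e::{ordered_real_vector, lattice_ab_group_add_abs}"
  shows "\<bar>c *\<^sub>R x\<bar> \<le> \<bar>c\<bar> *\<^sub>R \<bar>x\<bar>"
proof (cases "0 \<le> c")
  case True
  then show ?thesis
    using scaleR_left_mono[OF abs_ge_self, of c x] scaleR_left_mono[OF abs_ge_minus_self, of c x]
    by (auto intro: abs_leI)
next
  case False
  then show ?thesis
    using scaleR_left_mono[OF abs_ge_self, of "-c" x] scaleR_left_mono[OF abs_ge_minus_self, of "-c" x]
    by (auto intro: abs_leI)
qed

lemma order_convergent_0: "order_convergent (\<lambda>_. 0)"
  unfolding order_convergent_def order_converges_to_def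
  by (intro exI[of _ 0] exI[of _ "\<lambda>_. 0"]) (auto simp: decreases_to_0_iff decseq_def)

lemma order_convergent_add:
  assumes "order_convergent u" "order_convergent v"
  shows "order_convergent (\<lambda>n. u n + v n)"
proof -
  obtain k l y z where *: "decreases_to y 0" "decreases_to z 0"
    "\<And>n. \<bar>u n - k\<bar> \<le> y n" "\<And>n. \<bar>v n - l\<bar> \<le> z n"
    using assms unfolding order_convergent_def order_converges_to_def by blast
  have "\<bar>u n + v n - (k + l)\<bar> \<le> y n + z n" for n
    using abs_triangle_ineq[of "u n - k" "v n - l"] add_mono[OF *(3,4)]
    by (metis add_diff_add order_trans)
  then show ?thesis
    using decreases_to_0_add[OF *(1,2)] unfolding order_convergent_def order_converges_to_def by blast
qed

lemma order_convergent_scaleR: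
  assumes "order_convergent u"
  shows "order_convergent (\<lambda>n. c *\<^sub>R u n)"
proof (cases "c = 0")
  case False
  obtain l y where *: "decreases_to y 0" "\<And>n. \<bar>u n - l\<bar> \<le> y n"
    using assms unfolding order_convergent_def order_converges_to_def by blast
  have "\<bar>c *\<^sub>R u n - c *\<^sub>R l\<bar> \<le> \<bar>c\<bar> *\<^sub>R y n" for n
    using abs_scaleR_le[of c "u n - l"] scaleR_left_mono[OF *(2), of "\<bar>c\<bar>"]
    by (metis abs_ge_zero order_trans scaleR_diff_right)
  then show ?thesis
    using decreases_to_0_scaleR[OF *(1), of "\<bar>c\<bar>"] False
    unfolding order_convergent_def order_converges_to_def by auto
qed (simp add: order_convergent_0)

lemma subspace_convergence_set:
  assumes "\<And>n. linear (T n)"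
  shows "subspace (convergence_set T)"
  using assms
  by (auto simp: subspace_def convergence_set_def linear_0 linear_add linear_scale
      order_convergent_0 order_convergent_add order_convergent_scaleR)

section \<open>Order Cauchy sequences\<close>

lemma sigma_complete_isLub_range:
  fixes u :: "nat \<Rightarrow> 'e::{ordered_real_vector, lattice_ab_group_add_abs}"
  assumes "dedekind_sigma_complete TYPE('e)" "bdd_above (range u)"
  shows "\<exists>s. isLub UNIV (range u) s"
  using assms by (simp add: dedekind_sigma_complete_def)

text \<open>
  The last hypothesis says that the eventual upper bounds \<open>d\<close> of \<open>\<bar>u n - u m\<bar>\<close> have infimum \<open>0\<close>.
\<close>

lemma order_convergent_if_order_Cauchy:
  fixes u :: "nat \<Rightarrow> 'e::{ordered_real_vector, lattice_ab_group_add_abs}"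
  assumes dsc: "dedekind_sigma_complete TYPE('e)"
    and bdd: "order_bounded (range u)"
    and Cauchy: "\<And>b. (\<And>N d. (\<And>n m. N \<le> n \<Longrightarrow> N \<le> m \<Longrightarrow> \<bar>u n - u m\<bar> \<le> d) \<Longrightarrow> b \<le> d) \<Longrightarrow> b \<le> 0"
  shows "order_convergent u"
proof -
  obtain p q where pq: "\<And>n. p \<le> u n" "\<And>n. u n \<le> q"
    using bdd unfolding order_bounded_def by (meson atLeastAtMost_iff rangeI subsetD)
  \<comment> \<open>The supremum \<open>D N\<close> of \<open>A N\<close> is the order oscillation
    of the tail from \<open>N\<close> on; it will dominate the distance to the limit.\<close>
  define A where "A N = (\<lambda>(n, m). \<bar>u n - u m\<bar>) ` ({N..} \<times> {N..})" for N :: nat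
  have "\<exists>s. isLub UNIV (A N) s" for N
  proof -
    have "\<bar>u n - u m\<bar> \<le> q - p" for n m
      using diff_mono[OF pq(2)[of n] pq(1)[of m]] diff_mono[OF pq(2)[of m] pq(1)[of n]]
      by (auto intro!: abs_leI)
    then have "bdd_above (A N)" by (auto simp: A_def bdd_above_def)
    moreover have "A N \<noteq> {}" "countable (A N)" by (auto simp: A_def)
    ultimately show ?thesis
      using dsc unfolding dedekind_sigma_complete_def by blast
  qed
  then obtain D where D: "\<And>N. isLub UNIV (A N) (D N)" by metis
  have osc: "\<bar>u n - u m\<bar> \<le> D N" if "N \<le> n" "N \<le> m" for N n m
    using D[of N] that by (force simp: isLub_UNIV_iff A_def)
  have least: "D N \<le> d" if "\<And>n m. N \<le> n \<Longrightarrow> N \<le> m \<Longrightarrow> \<bar>u n - u m\<bar> \<le> d" for N d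
    using D[of N] that by (force simp: isLub_UNIV_iff A_def)
  have dec: "decreases_to D 0"
    unfolding decreases_to_0_iff
  proof (intro conjI allI impI)
    show "decseq D"
      unfolding decseq_def by (auto intro!: least osc)
    show "0 \<le> D n" for n
      using osc[of n n n] by simp
    \<comment> \<open>Leastness puts \<open>D N\<close> below every bound \<open>d\<close> valid
      from \<open>N\<close> on, so a lower bound of all \<open>D N\<close> is a lower bound of all
      such \<open>d\<close>.\<close>
    show "b \<le> 0" if "\<forall>n. b \<le> D n" for b
      using that least by (intro Cauchy) (meson order_trans)
  qed
  \<comment> \<open>The intervals \<open>[u n - D n, u n + D n]\<close> meet pairwise, since
    \<open>u (max n m)\<close> lies in both. Hence the supremum \<open>l\<close> of the left ends
    lies in every one of them.\<close>
  have cross: "u n - D n \<le> u m + D m" for n m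
  proof -
    have "u n - u (max n m) \<le> D n" "u (max n m) - u m \<le> D m"
      using osc[of n n "max n m"] osc[of m "max n m" m] by (auto dest: abs_le_D1)
    then show ?thesis
      using add_mono by (fastforce simp: algebra_simps)
  qed
  have "bdd_above (range (\<lambda>n. u n - D n))"
    using cross by (auto simp: bdd_above_def)
  then obtain l where "isLub UNIV (range (\<lambda>n. u n - D n)) l"
    using sigma_complete_isLub_range[OF dsc] by blast
  then have l: "u n - D n \<le> l" "l \<le> u n + D n" for n
    using cross by (auto simp: isLub_UNIV_iff)
  have "\<bar>u n - l\<bar> \<le> D n" for n
    using l[of n] by (intro abs_leI) (simp_all add: algebra_simps)
  with dec show ?thesis
    unfolding order_convergent_def order_converges_to_def by blast
qed

section \<open>Solid neighbourhoods of zero\<close>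

text \<open>\<open>U\<close> itself need not be open: the solid sets supplied by
  \<open>locally_solid\<close> are only required to contain an open set around zero.\<close>

definition solid_nbhd where
  "solid_nbhd \<tau> U \<longleftrightarrow> solid U \<and> (\<exists>W. openin \<tau> W \<and> 0 \<in> W \<and> W \<subseteq> U)"

lemma solid_nbhd_0: "solid_nbhd \<tau> U \<Longrightarrow> 0 \<in> U"
  by (auto simp: solid_nbhd_def)

lemma solid_nbhd_mono:
  assumes "solid_nbhd \<tau> U" "a \<in> U" "\<bar>b\<bar> \<le> a" shows "b \<in> U"
  using assms abs_ge_self[of a] unfolding solid_nbhd_def solid_def by (meson order_trans)

lemma solid_nbhd_abs: "solid_nbhd \<tau> U \<Longrightarrow> a \<in> U \<Longrightarrow> \<bar>a\<bar> \<in> U"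
  unfolding solid_nbhd_def solid_def by (auto dest: spec[of _ a])

lemma solid_nbhd_within:
  assumes "locally_solid \<tau>" "openin \<tau> W" "0 \<in> W"
  obtains U where "solid_nbhd \<tau> U" "U \<subseteq> W"
  using assms unfolding locally_solid_def neighbourhood_base_at_def solid_nbhd_def by meson

lemma limitin_0_solid_nbhd:
  assumes "limitin \<tau> f 0 F" "solid_nbhd \<tau> U"
  shows "\<forall>\<^sub>F x in F. f x \<in> U"
proof -
  obtain W where "openin \<tau> W" "0 \<in> W" "W \<subseteq> U"
    using assms(2) by (auto simp: solid_nbhd_def)
  then show ?thesis
    using assms(1) unfolding limitin_def by (auto elim!: eventually_mono)
qed

text \<open>The substitute for halving an epsilon. Continuity of addition at \<open>(0, 0)\<close>
  yields open \<open>P\<close> and \<open>Q\<close>, and any solid neighbourhood inside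
  \<open>P \<inter> Q\<close> works.\<close>

lemma solid_nbhd_half:
  assumes "linear_topology \<tau>" "locally_solid \<tau>" "solid_nbhd \<tau> U"
  obtains V where "solid_nbhd \<tau> V" "\<And>a b. a \<in> V \<Longrightarrow> b \<in> V \<Longrightarrow> a + b \<in> U"
proof -
  obtain W where W: "openin \<tau> W" "0 \<in> W" "W \<subseteq> U"
    using assms(3) by (auto simp: solid_nbhd_def)
  have "openin (prod_topology \<tau> \<tau>) {p \<in> topspace (prod_topology \<tau> \<tau>). (\<lambda>(x, y). x + y) p \<in> W}"
    using assms(1) W by (intro openin_continuous_map_preimage) (auto simp: linear_topology_def)
  moreover have "topspace \<tau> = UNIV"
    using assms(1) by (simp add: linear_topology_def)
  ultimately have "openin (prod_topology \<tau> \<tau>) {(x, y). x + y \<in> W}"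
    by (simp add: case_prod_unfold)
  moreover have "(0, 0) \<in> {(x, y). x + y \<in> W}"
    using W by simp
  ultimately obtain P Q where PQ: "openin \<tau> P" "openin \<tau> Q" "0 \<in> P" "0 \<in> Q" "P \<times> Q \<subseteq> {(x, y). x + y \<in> W}"
    unfolding openin_prod_topology_alt by meson
  then have "openin \<tau> (P \<inter> Q)" "0 \<in> P \<inter> Q"
    by auto
  then obtain V where "solid_nbhd \<tau> V" "V \<subseteq> P \<inter> Q"
    using solid_nbhd_within[OF assms(2)] by metis
  moreover from this have "V \<times> V \<subseteq> {(x, y). x + y \<in> U}"
    using PQ(5) W(3) by blast
  ultimately show ?thesis
    by (intro that[of V]) auto
qed

text \<open>Scalar multiplication is continuous in the scalar and
  \<open>inverse (real (Suc k))\<close> tends to zero. Using a sequence of scalars keeps the later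
  Baire cover countable.\<close>

lemma solid_nbhd_absorbing:
  assumes "linear_topology \<tau>" "solid_nbhd \<tau> U"
  shows "\<exists>k::nat. inverse (real (Suc k)) *\<^sub>R x \<in> U"
proof -
  obtain W where W: "openin \<tau> W" "0 \<in> W" "W \<subseteq> U"
    using assms(2) by (auto simp: solid_nbhd_def)
  have "continuous_map euclideanreal \<tau> ((\<lambda>(c, x). c *\<^sub>R x) \<circ> (\<lambda>c. (c, x)))"
    using assms(1) unfolding linear_topology_def
    by (intro continuous_map_compose[where X' = "prod_topology euclideanreal \<tau>"] continuous_map_pairedI) auto
  then have "open {c. c *\<^sub>R x \<in> W}"
    using openin_continuous_map_preimage[OF _ W(1)] by (fastforce simp: o_def)
  moreover have "(\<lambda>k. inverse (real (Suc k))) \<longlonglongrightarrow> 0"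
    by (rule LIMSEQ_inverse_real_of_nat)
  ultimately have "\<forall>\<^sub>F k in sequentially. inverse (real (Suc k)) \<in> {c. c *\<^sub>R x \<in> W}"
    using W by (intro topological_tendstoD) auto
  then show ?thesis
    using W by (auto simp: eventually_sequentially)
qed

text \<open>Each added term costs one halving of \<open>U\<close>, which is why the terms are
  assumed to be eventually in every solid neighbourhood \<open>V\<close>.\<close>

lemma eventually_sum_in_solid_nbhd:
  assumes "linear_topology \<tau>" "locally_solid \<tau>" "solid_nbhd \<tau> U"
    and "\<And>i V. i \<in> I \<Longrightarrow> solid_nbhd \<tau> V \<Longrightarrow> \<forall>\<^sub>F h in F. f i h \<in> V" "finite I"
  shows "\<forall>\<^sub>F h in F. (\<Sum>i\<in>I. f i h) \<in> U"
  using assms(5,3,4)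
proof (induction I arbitrary: U rule: finite_induct)
  case empty
  then show ?case by (simp add: solid_nbhd_0)
next
  case (insert i I)
  obtain V where V: "solid_nbhd \<tau> V" "\<And>a b. a \<in> V \<Longrightarrow> b \<in> V \<Longrightarrow> a + b \<in> U"
    using solid_nbhd_half[OF assms(1,2) insert.prems(1)] by metis
  have "\<forall>\<^sub>F h in F. f i h \<in> V" "\<forall>\<^sub>F h in F. (\<Sum>i\<in>I. f i h) \<in> V"
    using insert V by auto
  then show ?case
    by eventually_elim (use insert V in auto)
qed

text \<open>A nonzero \<open>x\<close> is separated from zero by disjoint open sets, and the one
  around zero contains a solid neighbourhood that misses \<open>x\<close>.\<close>

lemma eq_0_if_in_all_solid_nbhds:
  assumes "linear_topology \<tau>" "Hausdorff_space \<tau>" "locally_solid \<tau>"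
    and "\<And>U. solid_nbhd \<tau> U \<Longrightarrow> x \<in> U"
  shows "x = 0"
proof (rule ccontr)
  assume "x \<noteq> 0"
  then obtain W W' where "openin \<tau> W" "openin \<tau> W'" "x \<in> W" "0 \<in> W'" "disjnt W W'"
    using assms(1,2) unfolding Hausdorff_space_def linear_topology_def by (metis UNIV_I)
  moreover then obtain U where "solid_nbhd \<tau> U" "U \<subseteq> W'"
    using solid_nbhd_within[OF assms(3)] by metis
  ultimately show False
    using assms(4) by (auto simp: disjnt_iff)
qed

section \<open>The maximal operator\<close>

text \<open>Otherwise Baire's theorem would give the union empty interior, although it is the whole,
  nonempty space.\<close>

lemma Baire_UN_closed_interior:
  fixes A :: "nat \<Rightarrow> 'x::complete_space set"
  assumes "\<And>k. closed (A k)" "(\<Union>k. A k) = UNIV"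
  shows "\<exists>k. interior (A k) \<noteq> {}"
proof (rule ccontr)
  assume "\<not> ?thesis"
  then have "euclidean interior_of \<Union>(range A) = {}"
    using assms(1) completely_metrizable_space_euclidean
    by (intro Baire_category_alt) auto
  then show False
    using assms(2) by simp
qed

text \<open>The finite maxima \<open>P N\<close> are subadditive and even, so smallness on a ball
  found by Baire moves to the origin, uniformly in \<open>N\<close>. The property
  \<open>sigma_Lebesgue\<close> then passes from \<open>P N\<close> to \<open>M\<close>.\<close>

lemma maximal_operator_continuous_at_0:
  fixes T :: "nat \<Rightarrow> 'x::banach \<Rightarrow> 'e::{ordered_real_vector, lattice_ab_group_add_abs}"
  assumes top: "linear_topology \<tau>" "locally_solid \<tau>" "sigma_Lebesgue \<tau>"
    and lin: "\<And>n. linear (T n)"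
    and cont: "\<And>n. continuous_map euclidean \<tau> (T n)"
    and M: "\<And>x. isLub UNIV (range (\<lambda>n. \<bar>T n x\<bar>)) (M x)"
    and U: "solid_nbhd \<tau> U"
  shows "\<exists>r>0. \<forall>h. norm h < r \<longrightarrow> M h \<in> U"
proof -
  \<comment> \<open>Three halvings pay for three sums: \<open>V\<close> for approximating a closure
    point, \<open>V2\<close> for moving the ball to the origin, \<open>V1\<close> for replacing
    \<open>P N\<close> by \<open>M\<close>.\<close>
  obtain V1 where V1: "solid_nbhd \<tau> V1" "\<And>a b. a \<in> V1 \<Longrightarrow> b \<in> V1 \<Longrightarrow> a + b \<in> U"
    using solid_nbhd_half[OF top(1,2) U] by metis
  obtain V2 where V2: "solid_nbhd \<tau> V2" "\<And>a b. a \<in> V2 \<Longrightarrow> b \<in> V2 \<Longrightarrow> a + b \<in> V1"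
    using solid_nbhd_half[OF top(1,2) V1(1)] by metis
  obtain V where V: "solid_nbhd \<tau> V" "\<And>a b. a \<in> V \<Longrightarrow> b \<in> V \<Longrightarrow> a + b \<in> V2"
    using solid_nbhd_half[OF top(1,2) V2(1)] by metis
  have M_ge: "\<bar>T n x\<bar> \<le> M x" and M_least: "(\<And>n. \<bar>T n x\<bar> \<le> b) \<Longrightarrow> M x \<le> b" for n x b
    using M[of x] by (auto simp: isLub_UNIV_iff)
  define P where "P N x = Sup_fin ((\<lambda>n. \<bar>T n x\<bar>) ` {..N})" for N x
  have P_ge: "\<bar>T n x\<bar> \<le> P N x" if "n \<le> N" for n N x
    unfolding P_def using that by (intro Sup_fin.coboundedI) auto
  have P_le: "P N x \<le> b" if "\<And>n. n \<le> N \<Longrightarrow> \<bar>T n x\<bar> \<le> b" for N x b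
    unfolding P_def using that by (intro Sup_fin.boundedI) auto
  \<comment> \<open>Solidity applies because \<open>P N x\<close> dominates
    \<open>\<bar>T 0 x\<bar>\<close>, hence is nonnegative and equal to its absolute value.\<close>
  have P_mem: "P N x \<in> W" if "solid_nbhd \<tau> W" "a \<in> W" "P N x \<le> a" for N x W a
    using solid_nbhd_mono[OF that(1,2)] that(3) order_trans[OF abs_ge_zero P_ge[of 0 N x]] by simp
  have P_add: "P N (x + y) \<le> P N x + P N y" for N x y
  proof (rule P_le)
    fix n assume "n \<le> N"
    then have "\<bar>T n x\<bar> + \<bar>T n y\<bar> \<le> P N x + P N y"
      by (intro add_mono P_ge)
    then show "\<bar>T n (x + y)\<bar> \<le> P N x + P N y"
      using abs_triangle_ineq[of "T n x" "T n y"] by (simp add: linear_add[OF lin])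
  qed
  have P_minus: "P N (- x) = P N x" for N x
    by (simp add: P_def linear_neg[OF lin])
  \<comment> \<open>The maximum is dominated by the sum of the \<open>\<bar>T n h\<bar>\<close>,
    each of which is small by continuity of \<open>T n\<close>.\<close>
  have P_small: "\<forall>\<^sub>F h in nhds 0. P N h \<in> V" for N
  proof -
    have "\<forall>\<^sub>F h in nhds 0. \<bar>T n h\<bar> \<in> V'" if V': "solid_nbhd \<tau> V'" for n V'
    proof -
      obtain W where W: "openin \<tau> W" "0 \<in> W" "W \<subseteq> V'"
        using V' by (auto simp: solid_nbhd_def)
      have "open {h. T n h \<in> W}"
        using openin_continuous_map_preimage[OF cont W(1)] by simp
      then have "\<forall>\<^sub>F h in nhds 0. h \<in> {h. T n h \<in> W}"
        using W(2) by (intro eventually_nhds_in_open) (auto simp: linear_0[OF lin])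
      then show ?thesis
        by eventually_elim (use W solid_nbhd_abs[OF V'] in auto)
    qed
    then have "\<forall>\<^sub>F h in nhds 0. (\<Sum>n\<le>N. \<bar>T n h\<bar>) \<in> V"
      using top V(1) by (intro eventually_sum_in_solid_nbhd) auto
    then show ?thesis
    proof eventually_elim
      case (elim h)
      have "\<bar>T n h\<bar> \<le> (\<Sum>n\<le>N. \<bar>T n h\<bar>)" if "n \<le> N" for n
        using that sum_mono2[of "{..N}" "{n}" "\<lambda>n. \<bar>T n h\<bar>"] by simp
      then show ?case
        by (rule P_mem[OF V(1) elim P_le])
    qed
  qed
  define c where "c k = inverse (real (Suc k))" for k
  define A where "A k = {x. \<forall>N. P N (c k *\<^sub>R x) \<in> V}" for k
  \<comment> \<open>Baire needs closed sets, and \<open>A k\<close> need not be closed. Passing to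
    the closure only enlarges \<open>V\<close> to \<open>V2\<close>: a nearby \<open>y\<close> in
    \<open>A k\<close> differs from \<open>x\<close> by a vector on which \<open>P N\<close> is
    small.\<close>
  have closure_A: "P N (c k *\<^sub>R x) \<in> V2" if x: "x \<in> closure (A k)" for k x N
  proof -
    have "((\<lambda>y. c k *\<^sub>R (x - y)) \<longlongrightarrow> 0) (nhds x)"
      by (auto intro!: tendsto_eq_intros filterlim_ident)
    then have "\<forall>\<^sub>F y in nhds x. P N (c k *\<^sub>R (x - y)) \<in> V"
      using P_small[of N] unfolding filterlim_def le_filter_def eventually_filtermap by blast
    then obtain S where S: "open S" "x \<in> S" "\<forall>y\<in>S. P N (c k *\<^sub>R (x - y)) \<in> V"
      unfolding eventually_nhds by blast
    then obtain y where y: "y \<in> A k" "y \<in> S"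
      using x open_Int_closure_eq_empty[OF S(1), of "A k"] by blast
    have "P N (c k *\<^sub>R x) \<le> P N (c k *\<^sub>R (x - y)) + P N (c k *\<^sub>R y)"
      using P_add[of N "c k *\<^sub>R (x - y)" "c k *\<^sub>R y"] by (simp flip: scaleR_add_right)
    moreover have "P N (c k *\<^sub>R (x - y)) + P N (c k *\<^sub>R y) \<in> V2"
      using S y V by (auto simp: A_def)
    ultimately show ?thesis
      using P_mem[OF V2(1)] by blast
  qed
  have "(\<Union>k. closure (A k)) = UNIV"
  proof -
    \<comment> \<open>Order boundedness enters through \<open>M x\<close>: one absorbing scalar for
      this single element works for all \<open>N\<close> at once.\<close>
    have "\<exists>k. x \<in> A k" for x
    proof -
      obtain k where k: "c k *\<^sub>R M x \<in> V"
        using solid_nbhd_absorbing[OF top(1) V(1)] unfolding c_def by blast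
      have "P N (c k *\<^sub>R x) \<le> c k *\<^sub>R M x" for N
      proof (rule P_le)
        fix n
        have "0 \<le> c k" by (simp add: c_def)
        then show "\<bar>T n (c k *\<^sub>R x)\<bar> \<le> c k *\<^sub>R M x"
          using abs_scaleR_le[of "c k" "T n x"] scaleR_left_mono[OF M_ge, of "c k" n x]
          by (simp add: linear_scale[OF lin])
      qed
      then show ?thesis
        using P_mem[OF V(1) k] unfolding A_def by blast
    qed
    then show ?thesis
      using closure_subset by blast
  qed
  from Baire_UN_closed_interior[OF closed_closure this]
  obtain k x0 where "x0 \<in> interior (closure (A k))"
    by blast
  then obtain r where r: "0 < r" "ball x0 r \<subseteq> closure (A k)"
    unfolding mem_interior by blast
  have x0: "P N (c k *\<^sub>R x0) \<in> V2" for N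
    by (rule closure_A, rule subsetD[OF r(2)]) (simp add: r(1))
  have small: "M (c k *\<^sub>R z) \<in> U" if z: "norm z < r" for z
  proof -
    let ?z = "c k *\<^sub>R z"
    have P_V1: "P N ?z \<in> V1" for N
    proof -
      have "x0 + z \<in> ball x0 r"
        using z by (simp add: dist_norm)
      then have "P N (c k *\<^sub>R (x0 + z)) \<in> V2"
        using r closure_A by blast
      then have "P N (c k *\<^sub>R (x0 + z)) + P N (c k *\<^sub>R x0) \<in> V1"
        using x0 V2 by blast
      \<comment> \<open>Here \<open>z\<close> is written as \<open>(x0 + z) - x0\<close>, and
        evenness of \<open>P N\<close> removes the sign.\<close>
      moreover have "P N ?z \<le> P N (c k *\<^sub>R (x0 + z)) + P N (c k *\<^sub>R x0)"
        using P_add[of N "c k *\<^sub>R (x0 + z)" "- (c k *\<^sub>R x0)"] by (simp add: P_minus scaleR_add_right)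
      ultimately show ?thesis
        using P_mem[OF V1(1)] by blast
    qed
    have "decreases_to (\<lambda>N. M ?z - P N ?z) 0"
      unfolding decreases_to_0_iff
    proof (intro conjI allI impI)
      show "decseq (\<lambda>N. M ?z - P N ?z)"
        by (auto simp: decseq_def intro!: diff_left_mono P_le P_ge)
      show "0 \<le> M ?z - P N ?z" for N
        using P_le M_ge by simp
      \<comment> \<open>For a lower bound \<open>b\<close>, the element \<open>M ?z - b\<close>
        still dominates every \<open>\<bar>T n ?z\<bar>\<close>, so leastness of \<open>M ?z\<close>
        forces \<open>b \<le> 0\<close>.\<close>
      fix b assume b: "\<forall>N. b \<le> M ?z - P N ?z"
      have "M ?z \<le> M ?z - b"
      proof (rule M_least)
        fix n
        show "\<bar>T n ?z\<bar> \<le> M ?z - b"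
          using add_mono[OF P_ge[of n n ?z] b[rule_format, of n]] by (simp add: le_diff_eq)
      qed
      then show "b \<le> 0" by simp
    qed
    then have "limitin \<tau> (\<lambda>N. M ?z - P N ?z) 0 sequentially"
      using top(3) by (auto simp: sigma_Lebesgue_def)
    from limitin_0_solid_nbhd[OF this V1(1)] obtain N where N: "M ?z - P N ?z \<in> V1"
      by (auto simp: eventually_sequentially)
    show ?thesis
      using V1(2)[OF N P_V1[of N]] by simp
  qed
  have ck: "0 < c k" by (simp add: c_def)
  have "M h \<in> U" if "norm h < c k * r" for h
  proof -
    have "norm (inverse (c k) *\<^sub>R h) < r"
      using that ck by (simp add: field_simps)
    from small[OF this] show ?thesis
      using ck by simp
  qed
  then show ?thesis
    using ck r by (intro exI[of _ "c k * r"]) auto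
qed

section \<open>Closedness of the convergence set\<close>

lemma closed_convergence_set:
  fixes T :: "nat \<Rightarrow> 'x::banach \<Rightarrow> 'e::{ordered_real_vector, lattice_ab_group_add_abs}"
  assumes dsc: "dedekind_sigma_complete TYPE('e)"
    and top: "linear_topology \<tau>" "Hausdorff_space \<tau>" "locally_solid \<tau>" "sigma_Lebesgue \<tau>"
    and lin: "\<And>n. linear (T n)"
    and cont: "\<And>n. continuous_map euclidean \<tau> (T n)"
    and bdd: "\<And>x. order_bounded (range (\<lambda>n. T n x))"
  shows "closed (convergence_set T)"
proof -
  have "\<exists>s. isLub UNIV (range (\<lambda>n. \<bar>T n x\<bar>)) s" for x
  proof -
    obtain p q where pq: "\<And>n. p \<le> T n x" "\<And>n. T n x \<le> q"
      using bdd[of x] unfolding order_bounded_def by (meson atLeastAtMost_iff rangeI subsetD)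
    \<comment> \<open>The bound \<open>q\<close> controls \<open>T n x\<close> and
      \<open>- p\<close> controls its negative.\<close>
    then have "\<bar>T n x\<bar> \<le> sup q (- p)" for n
      by (intro abs_leI) (auto intro: le_supI1 le_supI2)
    then have "bdd_above (range (\<lambda>n. \<bar>T n x\<bar>))"
      by (auto simp: bdd_above_def)
    then show ?thesis
    using sigma_complete_isLub_range[OF dsc] by blast
  qed
  then obtain M where M: "\<And>x. isLub UNIV (range (\<lambda>n. \<bar>T n x\<bar>)) (M x)" by metis
  then have M_ge: "\<bar>T n x\<bar> \<le> M x" for n x
    by (auto simp: isLub_UNIV_iff)
  have "x \<in> convergence_set T" if x: "x \<in> closure (convergence_set T)" for x
  proof -
    have "b \<le> 0" if b: "\<And>N d. (\<And>n m. N \<le> n \<Longrightarrow> N \<le> m \<Longrightarrow> \<bar>T n x - T m x\<bar> \<le> d) \<Longrightarrow> b \<le> d" for b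
    proof -
      \<comment> \<open>Both \<open>T n x\<close> and \<open>T m x\<close> are compared with the
        order limit \<open>l\<close> of \<open>T n y\<close>; each comparison costs
        \<open>M (x - y)\<close> plus a term decreasing to zero.\<close>
      have b_le: "b \<le> M (x - y) + M (x - y)" if y: "y \<in> convergence_set T" for y
      proof -
        obtain w l where w: "decreases_to w 0" "\<And>n. \<bar>T n y - l\<bar> \<le> w n"
          using y unfolding convergence_set_def order_convergent_def order_converges_to_def by blast
        \<comment> \<open>With the part independent of \<open>N\<close> on the left, the infimum
          over \<open>N\<close> removes \<open>w N + w N\<close>.\<close>
        have "b - (M (x - y) + M (x - y)) \<le> w N + w N" for N
        proof -
          have near: "\<bar>T n x - l\<bar> \<le> M (x - y) + w N" if "N \<le> n" for n
          proof -
            have "w n \<le> w N"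
              using w(1) that by (simp add: decreases_to_0_iff decseq_def)
            then have "\<bar>T n (x - y)\<bar> + \<bar>T n y - l\<bar> \<le> M (x - y) + w N"
              by (intro add_mono M_ge order_trans[OF w(2)])
            then show ?thesis
              using abs_triangle_ineq[of "T n (x - y)" "T n y - l"]
              by (simp add: linear_diff[OF lin])
          qed
          have "b \<le> (M (x - y) + w N) + (M (x - y) + w N)"
          proof (rule b)
            fix n m assume "N \<le> n" "N \<le> m"
            then have "\<bar>T n x - l\<bar> + \<bar>T m x - l\<bar> \<le> (M (x - y) + w N) + (M (x - y) + w N)"
              by (intro add_mono near)
            then show "\<bar>T n x - T m x\<bar> \<le> \<dots>"
              using abs_triangle_ineq4[of "T n x - l" "T m x - l"] by simp
          qed
          then show ?thesis by (simp add: algebra_simps)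
        qed
        then have "b - (M (x - y) + M (x - y)) \<le> 0"
          using decreases_to_0_add[OF w(1) w(1)] unfolding decreases_to_0_iff by blast
        then show ?thesis by simp
      qed
      \<comment> \<open>Solidity needs a bound on an absolute value, and \<open>b\<close> is bounded
        only from above; hence the passage to its positive part. The bound
        \<open>M (x - y) + M (x - y)\<close> enters any given \<open>U\<close> as \<open>y\<close>
        approaches \<open>x\<close>.\<close>
      have "sup b 0 = 0"
      proof (rule eq_0_if_in_all_solid_nbhds[OF top(1-3)])
        fix U assume U: "solid_nbhd \<tau> U"
        obtain V where V: "solid_nbhd \<tau> V" "\<And>a b. a \<in> V \<Longrightarrow> b \<in> V \<Longrightarrow> a + b \<in> U"
          using solid_nbhd_half[OF top(1,3) U] by metis
        obtain r where r: "0 < r" "\<And>h. norm h < r \<Longrightarrow> M h \<in> V"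
          using maximal_operator_continuous_at_0[OF top(1,3,4) lin cont M V(1)] by auto
        obtain y where y: "y \<in> convergence_set T" "dist y x < r"
          using x r(1) unfolding closure_approachable by blast
        then have MV: "M (x - y) \<in> V"
          using r(2) by (simp add: dist_norm norm_minus_commute)
        have "0 \<le> M (x - y)"
          using order_trans[OF abs_ge_zero M_ge] .
        then have "\<bar>sup b 0\<bar> \<le> M (x - y) + M (x - y)"
          using b_le[OF y(1)] by simp
        then show "sup b 0 \<in> U"
          using solid_nbhd_mono[OF U V(2)[OF MV MV]] by blast
      qed
      then show ?thesis
        by (metis sup_ge1)
    qed
    then show ?thesis
      using order_convergent_if_order_Cauchy[OF dsc bdd] unfolding convergence_set_def by blast
  qed
  then show ?thesis
    by (auto simp flip: closure_subset_eq)
qed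

theorem theorem2p5:
  fixes T :: "nat \<Rightarrow> 'x::banach \<Rightarrow> 'e::{ordered_real_vector, lattice_ab_group_add_abs}"
    and \<tau> :: "'e topology"
  assumes "archimedean_lattice TYPE('e)"
    and "dedekind_sigma_complete TYPE('e)"
    and "linear_topology \<tau>" and "metrizable_space \<tau>" and "Hausdorff_space \<tau>"
    and "locally_solid \<tau>" and "sigma_Lebesgue \<tau>"
    and "\<And>n. linear (T n)"
    and "\<And>n. continuous_map euclidean \<tau> (T n)"
    and "\<And>x. order_bounded (range (\<lambda>n. T n x))"
  shows "(subspace (convergence_set T) \<and> closed (convergence_set T)) \<and>
         ((\<exists>D. closure D = UNIV \<and> (\<forall>x\<in>D. order_convergent (\<lambda>n. T n x)))
           \<longrightarrow> convergence_set T = UNIV)"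
proof (intro conjI impI)
  show "subspace (convergence_set T)"
    using assms(8) by (rule subspace_convergence_set)
  show closed: "closed (convergence_set T)"
    using assms(2,3,5-10) by (rule closed_convergence_set)
  assume "\<exists>D. closure D = UNIV \<and> (\<forall>x\<in>D. order_convergent (\<lambda>n. T n x))"
  then obtain D where "closure D = UNIV" "D \<subseteq> convergence_set T"
    by (auto simp: convergence_set_def)
  then show "convergence_set T = UNIV"
    using closure_minimal[OF _ closed] by blast
qed

end
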